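(* There exist a metric space $X$ with a basepoint $e\in X$ and a scaling factor $\alpha=(\alpha_n)_{n\in\mathbb{N}}$ such that for every non-principal ultrafilter $\mu$ on $\mathbb{N}$ and all natural numbers $i,j$ with $i\neq j$, the iterated asymptotic cones $\operatorname{Cone}^i_\mu(X,e,\alpha)$ and $\operatorname{Cone}^j_\mu(X,e,\alpha)$ are not homeomorphic.
   Context: A scaling factor is a sequence $\alpha=(\alpha_n)_{n\in\mathbb{N}}$ of positive real numbers diverging to $+\infty$. For an ultrafilter $\mu$ on $\mathbb{N}$ and a sequence $(x_n)$ in $[0,+\infty]$, $\mu\text{-}\lim x_n$ is the unique $a\in[0,+\infty]$ such that for every neighborhood $U$ of $a$ one has $\{n: x_n\in U\}\in\mu$. Asymptotic cone: for a metric space $(X,d)$, a non-principal ultrafilter $\mu$ on $\mathbb{N}$, a sequence $e=(e_n)$ of points of $X$ (a single point $e\in X$ is identified with the constant sequence) and a scaling factor $\alpha$, $\operatorname{Cone}_\mu(X,e,\alpha)$ is the quotient of $\{(x_n)\in X^{\mathbb{N}}: \mu\text{-}\lim d(x_n,e_n)/\alpha_n<+\infty\}$ by the relation $(x_n)\approx(y_n)\iff \mu\text{-}\lim d(x_n,y_n)/\alpha_n=0$, with metric $d_\infty([x_n],[y_n])=\mu\text{-}\lim d(x_n,y_n)/\alpha_n$. Iterated asymptotic cones: for $e\in X$ set $\operatorname{Cone}^0_\mu(X,e,\alpha)=X$, $e(0)=e$, and for $i\in\mathbb{N}$ set $\operatorname{Cone}^{i+1}_\mu(X,e,\alpha)=\operatorname{Cone}_\mu(\operatorname{Cone}^i_\mu(X,e,\alpha),e(i),\alpha)$,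 where $e(i+1)$ is the class of the constant sequence with value $e(i)$. Natural numbers include $0$. *)

theory Defs
  imports "HOL-Analysis.Analysis"
begin

section \<open>Non-principal ultrafilters and scaling factors\<close>

text \<open>
  Filters are library filters: a set \<open>A\<close> belongs to \<open>\<mu>\<close> iff \<open>eventually (\<lambda>n. n \<in> A) \<mu>\<close>.
  The limit of a sequence in \<open>[0,\<infinity>]\<close> along \<open>\<mu>\<close> is the library's \<open>Lim \<mu> x\<close> at type
  \<^typ>\<open>ennreal\<close>, that is \<open>THE a. (x \<longlongrightarrow> a) \<mu>\<close>.
\<close>

definition ultrafilter :: "'a filter \<Rightarrow> bool" where
  "ultrafilter \<mu> \<longleftrightarrow> \<mu> \<noteq> bot \<and> (\<forall>P. eventually P \<mu> \<or> eventually (\<lambda>x. \<not> P x) \<mu>)"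

definition nonprincipal_ultrafilter :: "'a filter \<Rightarrow> bool" where
  "nonprincipal_ultrafilter \<mu> \<longleftrightarrow> ultrafilter \<mu> \<and> (\<forall>x. \<mu> \<noteq> principal {x})"

definition scaling_factor :: "(nat \<Rightarrow> real) \<Rightarrow> bool" where
  "scaling_factor \<alpha> \<longleftrightarrow> (\<forall>n. 0 < \<alpha> n) \<and> filterlim \<alpha> at_top sequentially"

lemma ultrafilter_tendsto_Lim:
  fixes f :: "'a \<Rightarrow> ennreal"
  assumes "ultrafilter \<mu>"
  shows "(f \<longlongrightarrow> Lim \<mu> f) \<mu>"
proof -
  define l where "l = Inf {a. eventually (\<lambda>n. f n \<le> a) \<mu>}"
  have "(f \<longlongrightarrow> l) \<mu>"
  proof (rule order_tendstoI)
    fix a assume "a < l"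
    have "\<not> eventually (\<lambda>n. f n \<le> a) \<mu>"
    proof
      assume "eventually (\<lambda>n. f n \<le> a) \<mu>"
      then have "l \<le> a"
        unfolding l_def by (intro Inf_lower) simp
      with \<open>a < l\<close> show False by simp
    qed
    then have "eventually (\<lambda>n. \<not> f n \<le> a) \<mu>"
      using assms unfolding ultrafilter_def by blast
    then show "eventually (\<lambda>n. a < f n) \<mu>"
      by (simp add: not_le)
  next
    fix a assume "l < a"
    then obtain b where "b < a" and b: "eventually (\<lambda>n. f n \<le> b) \<mu>"
      unfolding l_def Inf_less_iff by blast
    from b show "eventually (\<lambda>n. f n < a) \<mu>"
      by (rule eventually_mono) (use \<open>b < a\<close> in auto)
  qed
  then show ?thesis
    using assms by (simp add: tendsto_Lim ultrafilter_def)
qed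

section \<open>Asymptotic cones\<close>

definition seq_dist :: "nat filter \<Rightarrow> 'a metric \<Rightarrow> (nat \<Rightarrow> real) \<Rightarrow> (nat \<Rightarrow> 'a) \<Rightarrow> (nat \<Rightarrow> 'a) \<Rightarrow> ennreal" where
  "seq_dist \<mu> X \<alpha> x y = Lim \<mu> (\<lambda>n. ennreal (mdist X (x n) (y n) / \<alpha> n))"

definition cone_seqs :: "nat filter \<Rightarrow> 'a metric \<Rightarrow> (nat \<Rightarrow> 'a) \<Rightarrow> (nat \<Rightarrow> real) \<Rightarrow> (nat \<Rightarrow> 'a) set" where
  "cone_seqs \<mu> X e \<alpha> = {x. (\<forall>n. x n \<in> mspace X) \<and> seq_dist \<mu> X \<alpha> x e < \<infinity>}"

definition cone_rel :: "nat filter \<Rightarrow> 'a metric \<Rightarrow> (nat \<Rightarrow> 'a) \<Rightarrow> (nat \<Rightarrow> real) \<Rightarrow> ((nat \<Rightarrow> 'a) \<times> (nat \<Rightarrow> 'a)) set" where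
  "cone_rel \<mu> X e \<alpha> =
    {(x, y). x \<in> cone_seqs \<mu> X e \<alpha> \<and> y \<in> cone_seqs \<mu> X e \<alpha> \<and> seq_dist \<mu> X \<alpha> x y = 0}"

definition cone_class :: "nat filter \<Rightarrow> 'a metric \<Rightarrow> (nat \<Rightarrow> 'a) \<Rightarrow> (nat \<Rightarrow> real) \<Rightarrow> (nat \<Rightarrow> 'a) \<Rightarrow> (nat \<Rightarrow> 'a) set" where
  "cone_class \<mu> X e \<alpha> x = cone_rel \<mu> X e \<alpha> `` {x}"

text \<open>
  The distance of two classes is read off from chosen representatives; by
  \<open>mdist_asymptotic_cone\<close> below it does not depend on the choice.
\<close>

definition asymptotic_cone :: "nat filter \<Rightarrow> 'a metric \<Rightarrow> (nat \<Rightarrow> 'a) \<Rightarrow> (nat \<Rightarrow> real) \<Rightarrow> (nat \<Rightarrow> 'a) set metric" where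
  "asymptotic_cone \<mu> X e \<alpha> =
    metric (cone_seqs \<mu> X e \<alpha> // cone_rel \<mu> X e \<alpha>,
            \<lambda>A B. enn2real (seq_dist \<mu> X \<alpha> (SOME x. x \<in> A) (SOME y. y \<in> B)))"

lemma seq_dist_commute: "seq_dist \<mu> X \<alpha> x y = seq_dist \<mu> X \<alpha> y x"
  by (simp add: seq_dist_def mdist_commute)

context
  fixes \<mu> :: "nat filter" and X :: "'a metric" and \<alpha> :: "nat \<Rightarrow> real"
  assumes uf: "ultrafilter \<mu>" and pos: "\<And>n. 0 < \<alpha> n"
begin

lemma seq_dist_refl:
  assumes "\<And>n. x n \<in> mspace X"
  shows "seq_dist \<mu> X \<alpha> x x = 0"
proof -
  have "mdist X (x n) (x n) = 0" for n
    using assms[of n] by simp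
  then show ?thesis
    using uf by (simp add: seq_dist_def tendsto_Lim ultrafilter_def)
qed

lemma seq_dist_triangle:
  assumes "\<And>n. x n \<in> mspace X" "\<And>n. y n \<in> mspace X" "\<And>n. z n \<in> mspace X"
  shows "seq_dist \<mu> X \<alpha> x z \<le> seq_dist \<mu> X \<alpha> x y + seq_dist \<mu> X \<alpha> y z"
  unfolding seq_dist_def
proof (rule tendsto_le)
  show "\<mu> \<noteq> bot" using uf by (simp add: ultrafilter_def)
  show "\<forall>\<^sub>F n in \<mu>. ennreal (mdist X (x n) (z n) / \<alpha> n)
      \<le> ennreal (mdist X (x n) (y n) / \<alpha> n) + ennreal (mdist X (y n) (z n) / \<alpha> n)"
  proof (intro always_eventually allI)
    fix n
    have "mdist X (x n) (z n) / \<alpha> n \<le> (mdist X (x n) (y n) + mdist X (y n) (z n)) / \<alpha> n"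
      using assms pos[of n] by (intro divide_right_mono mdist_triangle) auto
    then have "ennreal (mdist X (x n) (z n) / \<alpha> n)
        \<le> ennreal (mdist X (x n) (y n) / \<alpha> n + mdist X (y n) (z n) / \<alpha> n)"
      by (intro ennreal_leI) (simp add: add_divide_distrib)
    also have "\<dots> = ennreal (mdist X (x n) (y n) / \<alpha> n) + ennreal (mdist X (y n) (z n) / \<alpha> n)"
      using pos[of n] by (intro ennreal_plus) auto
    finally show "ennreal (mdist X (x n) (z n) / \<alpha> n)
        \<le> ennreal (mdist X (x n) (y n) / \<alpha> n) + ennreal (mdist X (y n) (z n) / \<alpha> n)" .
  qed
  show "((\<lambda>n. ennreal (mdist X (x n) (z n) / \<alpha> n))
      \<longlongrightarrow> Lim \<mu> (\<lambda>n. ennreal (mdist X (x n) (z n) / \<alpha> n))) \<mu>"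
    by (rule ultrafilter_tendsto_Lim[OF uf])
  show "((\<lambda>n. ennreal (mdist X (x n) (y n) / \<alpha> n) + ennreal (mdist X (y n) (z n) / \<alpha> n))
      \<longlongrightarrow> Lim \<mu> (\<lambda>n. ennreal (mdist X (x n) (y n) / \<alpha> n))
        + Lim \<mu> (\<lambda>n. ennreal (mdist X (y n) (z n) / \<alpha> n))) \<mu>"
    by (rule tendsto_add[OF ultrafilter_tendsto_Lim[OF uf] ultrafilter_tendsto_Lim[OF uf]])
qed

context
  fixes e :: "nat \<Rightarrow> 'a"
  assumes e: "\<And>n. e n \<in> mspace X"
begin

lemma seq_dist_finite:
  assumes "x \<in> cone_seqs \<mu> X e \<alpha>" "y \<in> cone_seqs \<mu> X e \<alpha>"
  shows "seq_dist \<mu> X \<alpha> x y < \<infinity>"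
proof -
  have "seq_dist \<mu> X \<alpha> x y \<le> seq_dist \<mu> X \<alpha> x e + seq_dist \<mu> X \<alpha> e y"
    using assms e by (intro seq_dist_triangle) (auto simp: cone_seqs_def)
  also have "\<dots> < \<infinity>"
    using assms by (simp add: cone_seqs_def seq_dist_commute[of \<mu> X \<alpha> e])
  finally show ?thesis .
qed

lemma base_in_cone_seqs: "e \<in> cone_seqs \<mu> X e \<alpha>"
  using e by (simp add: cone_seqs_def seq_dist_refl)

lemma equiv_cone_rel: "equiv (cone_seqs \<mu> X e \<alpha>) (cone_rel \<mu> X e \<alpha>)"
proof (rule equivI)
  show "cone_rel \<mu> X e \<alpha> \<subseteq> cone_seqs \<mu> X e \<alpha> \<times> cone_seqs \<mu> X e \<alpha>"
    by (auto simp: cone_rel_def)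
  show "refl_on (cone_seqs \<mu> X e \<alpha>) (cone_rel \<mu> X e \<alpha>)"
  proof (rule refl_onI)
    fix x assume x: "x \<in> cone_seqs \<mu> X e \<alpha>"
    then have "seq_dist \<mu> X \<alpha> x x = 0"
      by (intro seq_dist_refl) (simp add: cone_seqs_def)
    with x show "(x, x) \<in> cone_rel \<mu> X e \<alpha>"
      by (simp add: cone_rel_def)
  qed
  show "sym (cone_rel \<mu> X e \<alpha>)"
    unfolding sym_def cone_rel_def by (simp add: seq_dist_commute)
  show "trans (cone_rel \<mu> X e \<alpha>)"
  proof (rule transI)
    fix x y z assume *: "(x, y) \<in> cone_rel \<mu> X e \<alpha>" "(y, z) \<in> cone_rel \<mu> X e \<alpha>"
    then have "seq_dist \<mu> X \<alpha> x z \<le> seq_dist \<mu> X \<alpha> x y + seq_dist \<mu> X \<alpha> y z"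
      by (intro seq_dist_triangle) (auto simp: cone_rel_def cone_seqs_def)
    with * show "(x, z) \<in> cone_rel \<mu> X e \<alpha>"
      by (simp add: cone_rel_def)
  qed
qed

lemma seq_dist_cong:
  assumes "(x, x') \<in> cone_rel \<mu> X e \<alpha>" "(y, y') \<in> cone_rel \<mu> X e \<alpha>"
  shows "seq_dist \<mu> X \<alpha> x y = seq_dist \<mu> X \<alpha> x' y'"
proof -
  have le: "seq_dist \<mu> X \<alpha> u v \<le> seq_dist \<mu> X \<alpha> u' v'"
    if "(u, u') \<in> cone_rel \<mu> X e \<alpha>" "(v, v') \<in> cone_rel \<mu> X e \<alpha>" for u u' v v'
  proof -
    have m: "\<And>n. u n \<in> mspace X" "\<And>n. u' n \<in> mspace X" "\<And>n. v n \<in> mspace X" "\<And>n. v' n \<in> mspace X"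
      and z: "seq_dist \<mu> X \<alpha> u u' = 0" "seq_dist \<mu> X \<alpha> v' v = 0"
      using that by (auto simp: cone_rel_def cone_seqs_def seq_dist_commute)
    have "seq_dist \<mu> X \<alpha> u v \<le> seq_dist \<mu> X \<alpha> u' v"
      using seq_dist_triangle[of u u' v] m z(1) by simp
    also have "\<dots> \<le> seq_dist \<mu> X \<alpha> u' v'"
      using seq_dist_triangle[of u' v' v] m z(2) by simp
    finally show ?thesis .
  qed
  have "sym (cone_rel \<mu> X e \<alpha>)" using equiv_cone_rel by (simp add: equiv_def)
  with assms show ?thesis by (meson antisym le symD)
qed

lemma Metric_space_asymptotic_cone:
  "Metric_space (cone_seqs \<mu> X e \<alpha> // cone_rel \<mu> X e \<alpha>)
     (\<lambda>A B. enn2real (seq_dist \<mu> X \<alpha> (SOME x. x \<in> A) (SOME y. y \<in> B)))"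
proof -
  note eq = equiv_cone_rel
  have some: "(SOME x. x \<in> A) \<in> A" "(SOME x. x \<in> A) \<in> cone_seqs \<mu> X e \<alpha>"
    if "A \<in> cone_seqs \<mu> X e \<alpha> // cone_rel \<mu> X e \<alpha>" for A
    using in_quotient_imp_non_empty[OF eq that] in_quotient_imp_subset[OF eq that] some_in_eq[of A]
    by blast+
  show ?thesis
  proof
    fix A B assume AB: "A \<in> cone_seqs \<mu> X e \<alpha> // cone_rel \<mu> X e \<alpha>"
      "B \<in> cone_seqs \<mu> X e \<alpha> // cone_rel \<mu> X e \<alpha>"
    let ?x = "SOME x. x \<in> A" and ?y = "SOME y. y \<in> B"
    have "enn2real (seq_dist \<mu> X \<alpha> ?x ?y) = 0 \<longleftrightarrow> (?x, ?y) \<in> cone_rel \<mu> X e \<alpha>"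
      using seq_dist_finite[OF some(2)[OF AB(1)] some(2)[OF AB(2)]] some(2)[OF AB(1)] some(2)[OF AB(2)]
      by (auto simp: enn2real_eq_0_iff cone_rel_def)
    also have "\<dots> \<longleftrightarrow> A = B"
      using quotient_eq_iff[OF eq AB some(1)[OF AB(1)] some(1)[OF AB(2)]] by simp
    finally show "enn2real (seq_dist \<mu> X \<alpha> ?x ?y) = 0 \<longleftrightarrow> A = B" .
  next
    fix A B C assume A: "A \<in> cone_seqs \<mu> X e \<alpha> // cone_rel \<mu> X e \<alpha>"
      and B: "B \<in> cone_seqs \<mu> X e \<alpha> // cone_rel \<mu> X e \<alpha>"
      and C: "C \<in> cone_seqs \<mu> X e \<alpha> // cone_rel \<mu> X e \<alpha>"
    let ?x = "SOME x. x \<in> A" and ?y = "SOME x. x \<in> B" and ?z = "SOME x. x \<in> C"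
    have "seq_dist \<mu> X \<alpha> ?x ?z \<le> seq_dist \<mu> X \<alpha> ?x ?y + seq_dist \<mu> X \<alpha> ?y ?z"
      using some(2)[OF A] some(2)[OF B] some(2)[OF C]
      by (intro seq_dist_triangle) (auto simp: cone_seqs_def)
    moreover have "seq_dist \<mu> X \<alpha> ?x ?y < top"
      using seq_dist_finite[OF some(2)[OF A] some(2)[OF B]] by simp
    moreover have "seq_dist \<mu> X \<alpha> ?y ?z < top"
      using seq_dist_finite[OF some(2)[OF B] some(2)[OF C]] by simp
    ultimately show "enn2real (seq_dist \<mu> X \<alpha> ?x ?z)
        \<le> enn2real (seq_dist \<mu> X \<alpha> ?x ?y) + enn2real (seq_dist \<mu> X \<alpha> ?y ?z)"
      by (subst enn2real_plus[symmetric]) (auto intro: enn2real_mono)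
  qed (simp_all add: seq_dist_commute)
qed

lemma mspace_asymptotic_cone:
  "mspace (asymptotic_cone \<mu> X e \<alpha>) = cone_seqs \<mu> X e \<alpha> // cone_rel \<mu> X e \<alpha>"
  unfolding asymptotic_cone_def
  by (rule Metric_space.mspace_metric[OF Metric_space_asymptotic_cone])

lemma mdist_asymptotic_cone:
  assumes "x \<in> cone_seqs \<mu> X e \<alpha>" "y \<in> cone_seqs \<mu> X e \<alpha>"
  shows "mdist (asymptotic_cone \<mu> X e \<alpha>) (cone_class \<mu> X e \<alpha> x) (cone_class \<mu> X e \<alpha> y)
    = enn2real (seq_dist \<mu> X \<alpha> x y)"
proof -
  have "(x, SOME x'. x' \<in> cone_class \<mu> X e \<alpha> x) \<in> cone_rel \<mu> X e \<alpha>"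
    if "x \<in> cone_seqs \<mu> X e \<alpha>" for x
    using equiv_class_self[OF equiv_cone_rel that] some_in_eq[of "cone_class \<mu> X e \<alpha> x"]
    unfolding cone_class_def by blast
  from seq_dist_cong[OF this[OF assms(1)] this[OF assms(2)]] show ?thesis
    by (simp add: asymptotic_cone_def Metric_space.mdist_metric[OF Metric_space_asymptotic_cone])
qed

lemma cone_class_in_mspace:
  "x \<in> cone_seqs \<mu> X e \<alpha> \<Longrightarrow> cone_class \<mu> X e \<alpha> x \<in> mspace (asymptotic_cone \<mu> X e \<alpha>)"
  unfolding mspace_asymptotic_cone cone_class_def by (rule quotientI)

end

end

section \<open>Iterated asymptotic cones\<close>

text \<open>
  If \<open>X\<close> has type \<^typ>\<open>'a metric\<close>, its cone has type \<open>(nat \<Rightarrow> 'a) set metric\<close>, so the type grows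
  with each iteration.  To quantify over the number of iterations, each cone is copied
  isometrically into the single type \<open>'a iter_pt\<close>: a point of \<open>X\<close> is stored as a leaf, and a class
  of sequences as a node holding a chosen representative of that class.  Distinct classes have
  distinct representatives, so both encodings are injective (\<open>inj_Base_Pt\<close>, \<open>inj_on_encode_class\<close>)
  and the copies are isometric to the originals (\<open>mdist_metric_image\<close>).
\<close>

datatype 'a iter_pt = Base_Pt 'a | Seq_Pt "nat \<Rightarrow> 'a iter_pt"

definition encode_class :: "(nat \<Rightarrow> 'a iter_pt) set \<Rightarrow> 'a iter_pt" where
  "encode_class A = Seq_Pt (SOME x. x \<in> A)"

definition metric_image :: "('a \<Rightarrow> 'b) \<Rightarrow> 'a metric \<Rightarrow> 'b metric" where
  "metric_image f X =
    metric (f ` mspace X, \<lambda>p q. mdist X (inv_into (mspace X) f p) (inv_into (mspace X) f q))"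

fun iterated_cone :: "nat filter \<Rightarrow> 'a metric \<Rightarrow> 'a \<Rightarrow> (nat \<Rightarrow> real) \<Rightarrow> nat \<Rightarrow> 'a iter_pt metric"
  and iterated_base :: "nat filter \<Rightarrow> 'a metric \<Rightarrow> 'a \<Rightarrow> (nat \<Rightarrow> real) \<Rightarrow> nat \<Rightarrow> 'a iter_pt" where
  "iterated_cone \<mu> X e \<alpha> 0 = metric_image Base_Pt X"
| "iterated_cone \<mu> X e \<alpha> (Suc i) =
    metric_image encode_class
      (asymptotic_cone \<mu> (iterated_cone \<mu> X e \<alpha> i) (\<lambda>_. iterated_base \<mu> X e \<alpha> i) \<alpha>)"
| "iterated_base \<mu> X e \<alpha> 0 = Base_Pt e"
| "iterated_base \<mu> X e \<alpha> (Suc i) =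
    encode_class
      (cone_class \<mu> (iterated_cone \<mu> X e \<alpha> i) (\<lambda>_. iterated_base \<mu> X e \<alpha> i) \<alpha>
        (\<lambda>_. iterated_base \<mu> X e \<alpha> i))"

lemma Metric_space_metric_image:
  "Metric_space (f ` mspace X)
     (\<lambda>p q. mdist X (inv_into (mspace X) f p) (inv_into (mspace X) f q))"
proof
  fix p q assume "p \<in> f ` mspace X" "q \<in> f ` mspace X"
  then show "mdist X (inv_into (mspace X) f p) (inv_into (mspace X) f q) = 0 \<longleftrightarrow> p = q"
    by (metis f_inv_into_f inv_into_into mdist_zero)
next
  fix p q r assume "p \<in> f ` mspace X" "q \<in> f ` mspace X" "r \<in> f ` mspace X"
  then show "mdist X (inv_into (mspace X) f p) (inv_into (mspace X) f r)
      \<le> mdist X (inv_into (mspace X) f p) (inv_into (mspace X) f q)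
        + mdist X (inv_into (mspace X) f q) (inv_into (mspace X) f r)"
    by (intro mdist_triangle inv_into_into)
qed (simp_all add: mdist_commute)

lemma mspace_metric_image [simp]: "mspace (metric_image f X) = f ` mspace X"
  unfolding metric_image_def by (rule Metric_space.mspace_metric[OF Metric_space_metric_image])

lemma mdist_metric_image:
  assumes "inj_on f (mspace X)" "x \<in> mspace X" "y \<in> mspace X"
  shows "mdist (metric_image f X) (f x) (f y) = mdist X x y"
  using assms
  by (simp add: metric_image_def Metric_space.mdist_metric[OF Metric_space_metric_image])

lemma inj_Base_Pt: "inj Base_Pt"
  by (simp add: inj_def)

lemma inj_on_encode_class:
  assumes "ultrafilter \<mu>" "\<And>n. 0 < \<alpha> n" "\<And>n. e n \<in> mspace X"
  shows "inj_on encode_class (mspace (asymptotic_cone \<mu> X e \<alpha>))"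
proof (rule inj_onI)
  fix A B assume "A \<in> mspace (asymptotic_cone \<mu> X e \<alpha>)" "B \<in> mspace (asymptotic_cone \<mu> X e \<alpha>)"
    and eq: "encode_class A = encode_class B"
  then have AB: "A \<in> cone_seqs \<mu> X e \<alpha> // cone_rel \<mu> X e \<alpha>" "B \<in> cone_seqs \<mu> X e \<alpha> // cone_rel \<mu> X e \<alpha>"
    using mspace_asymptotic_cone[OF assms] by auto
  note equiv = equiv_cone_rel[OF assms]
  have "A \<noteq> {}" "B \<noteq> {}" using AB in_quotient_imp_non_empty[OF equiv] by auto
  then have "(SOME x. x \<in> A) \<in> A \<inter> B"
    using eq some_in_eq[of A] some_in_eq[of B] by (simp add: encode_class_def)
  then show "A = B" using quotient_disj[OF equiv AB] by blast
qed

lemma iterated_base_in_mspace: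
  assumes "ultrafilter \<mu>" "\<And>n. 0 < \<alpha> n" "e \<in> mspace X"
  shows "iterated_base \<mu> X e \<alpha> i \<in> mspace (iterated_cone \<mu> X e \<alpha> i)"
proof (induction i)
  case 0
  then show ?case using assms by simp
next
  case (Suc i)
  then show ?case
    by (auto intro!: imageI cone_class_in_mspace base_in_cone_seqs assms)
qed

end

theory Submission
  imports Defs "HOL-Real_Asymp.Real_Asymp"
begin

text \<open>
  If \<open>A\<close> is a closed subset of \<open>[0,\<infinity>)\<close> containing \<open>0\<close> and the sets \<open>A / \<alpha> n\<close> converge locally to a
  closed set \<open>B\<close>, then every cone of \<open>(A, 0)\<close> with scaling factor \<open>\<alpha>\<close> is isometric to \<open>B\<close>,
  whatever the ultrafilter.  We take a rapidly growing \<open>\<alpha>\<close> and place near the distance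
  \<open>\<alpha> n\<^sub>1 \<cdots> \<alpha> n\<^sub>j\<close> (with \<open>n\<^sub>1 > \<cdots> > n\<^sub>j\<close>) a finite set that approximates, as \<open>n\<^sub>j\<close> grows, a disjoint
  union of \<open>j\<close> convergent sequences.  Rescaling by \<open>\<alpha> n\<close> deletes the factor with \<open>n\<^sub>1 = n\<close>; after
  \<open>j\<close> such steps no factor is left and the whole union appears, while everything else stays
  discrete.  Hence the \<open>i\<close>-th cone has exactly \<open>i\<close> non-isolated points.
\<close>

section \<open>The model sets\<close>

text \<open>Each value is the fourth power of the preceding one. So \<open>cone_scale n\<close>
  exceeds the product of all earlier values with a factor \<open>4 ^ n\<close> to spare, while every
  later value is at least its square.\<close>

definition cone_scale :: "nat \<Rightarrow> real" where
  "cone_scale n = 2 ^ (4 ^ n)"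

text \<open>
  The convergent sequences are \<open>2 k + 1 + 1 / m\<close>; their limits are included as the case \<open>m = 0\<close>,
  because \<open>1 / 0 = 0\<close>.
\<close>

definition model :: "nat \<Rightarrow> real set" where
  "model i = insert 0 {prod cone_scale F * (2 * real k + 1 + 1 / real m) | F k m.
     finite F \<and> k < i + card F \<and> (\<forall>x\<in>F. m \<le> x)}"

lemma modelI:
  assumes "finite F" "k < i + card F" "\<And>x. x \<in> F \<Longrightarrow> m \<le> x"
  shows "prod cone_scale F * (2 * real k + 1 + 1 / real m) \<in> model i"
  using assms unfolding model_def by blast

lemma modelE:
  assumes "a \<in> model i"
  obtains "a = 0"
  | F k m where "a = prod cone_scale F * (2 * real k + 1 + 1 / real m)" "finite F" "k < i + card F"
      "\<And>x. x \<in> F \<Longrightarrow> m \<le> x"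
  using assms unfolding model_def by blast

lemma zero_in_model: "0 \<in> model i"
  by (simp add: model_def)

section \<open>Growth of the scaling factor\<close>

lemma scale_gt_1: "1 < cone_scale n"
  by (simp add: cone_scale_def)

lemma scale_pos: "0 < cone_scale n"
  using scale_gt_1[of n] by simp

lemma scale_ge: "real n < cone_scale n"
proof -
  have "n < 4 ^ n" by (rule power_gt_expt) simp
  also have "(4::nat) ^ n < 2 ^ (4 ^ n)" by (rule power_gt_expt) simp
  finally have "real n < real (2 ^ (4 ^ n))" by (simp only: of_nat_less_iff)
  then show ?thesis by (simp add: cone_scale_def)
qed

lemma scaling_factor_scale: "scaling_factor cone_scale"
proof -
  have "filterlim cone_scale at_top sequentially"
    by (rule filterlim_at_top_mono[OF filterlim_real_sequentially])
       (simp add: scale_ge less_imp_le)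
  then show ?thesis by (simp add: scaling_factor_def scale_pos)
qed

lemma scale_Suc: "cone_scale (Suc n) = cone_scale n ^ 4"
  by (simp add: cone_scale_def mult.commute flip: power_mult)

lemma scale_mono: "m \<le> n \<Longrightarrow> cone_scale m \<le> cone_scale n"
  by (simp add: cone_scale_def power_increasing)

lemma prod_scale_ge_1: "1 \<le> prod cone_scale F"
  by (rule prod_ge_1) (simp add: scale_gt_1 less_imp_le)

lemma prod_scale_ge_scale:
  assumes "finite F" "x \<in> F"
  shows "cone_scale x \<le> prod cone_scale F"
  using mult_mono[OF order_refl prod_scale_ge_1[of "F - {x}"], of "cone_scale x"] assms
  by (simp add: prod.remove[of F x] scale_pos less_imp_le)

text \<open>The induction step needs \<open>4 * cone_scale n ^ 2 \<le> cone_scale n ^ 4\<close>,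
  which holds because \<open>cone_scale n\<close> is at least 2. The slack \<open>4 ^ n\<close>
  later beats a factor that is linear in \<open>n\<close>.\<close>

lemma prod_scale_lessThan: "prod cone_scale {..<n} * 4 ^ n \<le> cone_scale n"
proof (induction n)
  case 0
  then show ?case by (simp add: cone_scale_def)
next
  case (Suc n)
  have "(2::real) ^ 1 \<le> 2 ^ (4 ^ n)"
    by (rule power_increasing) auto
  then have "2 ^ 2 \<le> cone_scale n ^ 2"
    unfolding cone_scale_def by (intro power_mono) auto
  then have "cone_scale n ^ 2 * 4 \<le> cone_scale n ^ 2 * cone_scale n ^ 2"
    by (intro mult_left_mono) auto
  moreover have "prod cone_scale {..<n} * 4 ^ n * (cone_scale n * 4) \<le> cone_scale n * (cone_scale n * 4)"
    using Suc scale_pos[of n] by (intro mult_right_mono) auto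
  ultimately show ?case
    by (simp add: scale_Suc lessThan_Suc power2_eq_square power4_eq_xxxx mult_ac)
qed

section \<open>Bounds and rescaling for points of the models\<close>

lemma factor_bounds:
  "1 \<le> 2 * real k + 1 + 1 / real m" "2 * real k + 1 + 1 / real m \<le> 2 * real k + 2"
  by (auto simp: divide_le_eq)

lemma model_nonneg:
  assumes "a \<in> model i"
  shows "0 \<le> a"
  using assms
proof (cases rule: modelE)
  case (2 F k m)
  then show ?thesis using prod_scale_ge_1[of F] by simp
qed simp

lemma model_element_ge:
  "prod cone_scale F \<le> prod cone_scale F * (2 * real k + 1 + 1 / real m)"
  using mult_left_mono[OF factor_bounds(1)[of k m], of "prod cone_scale F"] prod_scale_ge_1[of F]
  by simp

text \<open>A large \<open>n\<close> lies outside \<open>F\<close>, so multiplying by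
  \<open>cone_scale n\<close> inserts it. The cardinality rises by one, which keeps
  \<open>k < i + card F\<close> when \<open>Suc i\<close> drops to \<open>i\<close>;
  \<open>n \<ge> m\<close> keeps the lower bound on the elements.\<close>

lemma model_rescale_up:
  assumes "a \<in> model (Suc i)"
  shows "eventually (\<lambda>n. cone_scale n * a \<in> model i) sequentially"
  using assms
proof (cases rule: modelE)
  case 1
  then show ?thesis by (simp add: zero_in_model)
next
  case (2 F k m)
  obtain b where b: "\<And>x. x \<in> F \<Longrightarrow> x \<le> b"
    using \<open>finite F\<close> Max_ge by blast
  have "cone_scale n * a \<in> model i" if n: "n > b" "n \<ge> m" for n
  proof -
    have "n \<notin> F" using b n by fastforce
    moreover have "prod cone_scale (insert n F) * (2 * real k + 1 + 1 / real m) \<in> model i"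
      using 2 n \<open>n \<notin> F\<close> by (intro modelI) auto
    ultimately show ?thesis using 2 by (simp add: mult_ac)
  qed
  then show ?thesis
    using eventually_conj[OF eventually_gt_at_top[of b] eventually_ge_at_top[of m]]
    by (auto elim: eventually_mono)
qed

text \<open>The largest element of \<open>F\<close> decides. If it is \<open>n\<close>, the division
  cancels that factor; if it exceeds \<open>n\<close>, the quotient is huge; if all elements are
  below \<open>n\<close>, the quotient is at most a bound that vanishes as \<open>n\<close>
  grows.\<close>

lemma model_rescale_down:
  assumes "a \<in> model i"
  shows "a / cone_scale n \<in> model (Suc i) \<or> a / cone_scale n \<le> (2 * real (i + n) + 2) / 4 ^ n
    \<or> cone_scale n \<le> a / cone_scale n"
  using assms
proof (cases rule: modelE)
  case 1
  then show ?thesis by (simp add: zero_in_model)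
next
  case (2 F k m)
  consider x where "x \<in> F" "n < x" | "n \<in> F" "F \<subseteq> {..n}" | "F \<subseteq> {..<n}"
    by (metis atMost_iff lessThan_iff linorder_neqE_nat not_le subsetI)
  then show ?thesis
  proof cases
    case 1
    have "cone_scale n * cone_scale n \<le> cone_scale n ^ 4"
      using power_increasing[of 2 4 "cone_scale n"] scale_gt_1[of n] by (simp add: power2_eq_square)
    also have "\<dots> \<le> cone_scale x"
      using 1 scale_mono[of "Suc n" x] by (simp add: scale_Suc)
    also have "\<dots> \<le> prod cone_scale F"
      using 1 2 by (intro prod_scale_ge_scale)
    also have "\<dots> \<le> a"
      using 2 model_element_ge by simp
    finally show ?thesis using scale_pos[of n] by (simp add: le_divide_eq)
  next
    case 2: 2
    have "prod cone_scale (F - {n}) * (2 * real k + 1 + 1 / real m) \<in> model (Suc i)"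
      using \<open>finite F\<close> \<open>k < i + card F\<close> \<open>\<And>x. x \<in> F \<Longrightarrow> m \<le> x\<close> 2
      by (intro modelI) (auto simp: card_Diff_singleton card_gt_0_iff)
    moreover have "a / cone_scale n = prod cone_scale (F - {n}) * (2 * real k + 1 + 1 / real m)"
      using \<open>a = _\<close> \<open>finite F\<close> \<open>n \<in> F\<close> scale_pos[of n] by (simp add: prod.remove[of F n])
    ultimately show ?thesis by simp
  next
    case 3
    have "card F \<le> n"
      using card_mono[OF _ 3] by simp
    then have "2 * real k + 1 + 1 / real m \<le> 2 * real (i + n) + 2"
    proof -
      have "real k \<le> real (i + n)"
        using \<open>card F \<le> n\<close> \<open>k < i + card F\<close> by linarith
      then have "2 * real k + 2 \<le> 2 * real (i + n) + 2" by simp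
      with factor_bounds(2) show ?thesis by (rule order_trans)
    qed
    moreover have "prod cone_scale F \<le> prod cone_scale {..<n}"
      using 3 by (intro prod_mono2) (auto simp: scale_gt_1 scale_pos less_imp_le)
    ultimately have "a \<le> prod cone_scale {..<n} * (2 * real (i + n) + 2)"
      using \<open>a = _\<close> prod_scale_ge_1[of "{..<n}"] factor_bounds(1)[of k m]
      by (auto intro!: mult_mono)
    also have "\<dots> \<le> (cone_scale n / 4 ^ n) * (2 * real (i + n) + 2)"
      using prod_scale_lessThan[of n] by (intro mult_right_mono) (auto simp: le_divide_eq)
    finally show ?thesis
      using scale_pos[of n] by (simp add: field_simps)
  qed
qed

section \<open>Limit points of the models\<close>

text \<open>Boundedness leaves finitely many \<open>F\<close>, hence finitely many \<open>k\<close>,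
  and a nonempty \<open>F\<close> bounds \<open>m\<close>. Only \<open>F = {}\<close> allows
  infinitely many points, and these accumulate at the excluded centres.\<close>

lemma finite_model_away_from_limits:
  assumes "0 < \<delta>"
  shows "finite {a \<in> model i. a \<le> R \<and> (\<forall>k<i. \<delta> < dist a (2 * real k + 1))}"
proof -
  \<comment> \<open>The first summand bounds the elements of \<open>F\<close>, the second bounds
    \<open>m\<close> when \<open>F\<close> is empty.\<close>
  define N where "N = nat \<lceil>R\<rceil> + nat \<lceil>1 / \<delta>\<rceil>"
  define f where "f = (\<lambda>(F, k, m). prod cone_scale F * (2 * real k + 1 + 1 / real m))"
  have "a \<in> insert 0 (f ` (Pow {..N} \<times> {..i + Suc N} \<times> {..N}))"
    if a: "a \<in> model i" "a \<le> R" "\<And>k. k < i \<Longrightarrow> \<delta> < dist a (2 * real k + 1)" for a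
    using a(1)
  proof (cases rule: modelE)
    case (2 F k m)
    have "x \<le> nat \<lceil>R\<rceil>" if "x \<in> F" for x
    proof -
      have "real x < cone_scale x" by (rule scale_ge)
      also have "\<dots> \<le> prod cone_scale F" using that 2 by (intro prod_scale_ge_scale)
      also have "\<dots> \<le> R" using 2 a model_element_ge[of F k m] by simp
      finally show ?thesis by linarith
    qed
    then have FR: "F \<subseteq> {..nat \<lceil>R\<rceil>}" by auto
    then have F: "F \<subseteq> {..N}" unfolding N_def by auto
    then have "card F \<le> Suc N"
      using card_mono[of "{..N}" F] by simp
    moreover have "m \<le> N"
    proof (cases "F = {} \<and> m \<noteq> 0")
      case True
      with a(3)[of k] 2 have "\<delta> < 1 / real m"
        by (simp add: dist_real_def)
      with True \<open>0 < \<delta>\<close> have "real m < 1 / \<delta>"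
        by (simp add: field_simps)
      then show ?thesis unfolding N_def by linarith
    next
      case False
      then show ?thesis using 2 F by fastforce
    qed
    ultimately have "(F, k, m) \<in> Pow {..N} \<times> {..i + Suc N} \<times> {..N}"
      using F 2 by auto
    moreover have "a = f (F, k, m)" using 2 by (simp add: f_def)
    ultimately show ?thesis by blast
  qed simp
  then have "{a \<in> model i. a \<le> R \<and> (\<forall>k<i. \<delta> < dist a (2 * real k + 1))}
      \<subseteq> insert 0 (f ` (Pow {..N} \<times> {..i + Suc N} \<times> {..N}))"
    by blast
  then show ?thesis
    by (rule finite_subset) simp
qed

lemma islimpt_model_iff: "x islimpt model i \<longleftrightarrow> x \<in> (\<lambda>k. 2 * real k + 1) ` {..<i}"
proof
  let ?L = "(\<lambda>k. 2 * real k + 1) ` {..<i}"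
  assume lim: "x islimpt model i"
  show "x \<in> ?L"
  proof (rule ccontr)
    assume "x \<notin> ?L"
    moreover have "open (- ?L)"
      by (simp add: finite_imp_closed open_Compl)
    ultimately obtain e where e: "0 < e" "ball x e \<subseteq> - ?L"
      using openE[of "- ?L" x] by blast
    \<comment> \<open>Halving the radius keeps the whole ball uniformly away from the candidate
      limits, so it meets the model in a finite set.\<close>
    have *: "dist a (2 * real k + 1) > e / 2" if "a \<in> ball x (e / 2)" "k < i" for a k
    proof -
      have "2 * real k + 1 \<notin> ball x e" using e that by blast
      then have "e \<le> dist x a + dist a (2 * real k + 1)"
        using dist_triangle[of x "2 * real k + 1" a] by simp
      then show ?thesis using that(1) by simp
    qed
    then have "model i \<inter> ball x (e / 2)
        \<subseteq> {a \<in> model i. a \<le> x + e \<and> (\<forall>k<i. e / 2 < dist a (2 * real k + 1))}"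
    proof (intro subsetI CollectI conjI allI impI)
      fix a assume a: "a \<in> model i \<inter> ball x (e / 2)"
      then have "\<bar>x - a\<bar> < e / 2" by (simp add: dist_real_def)
      then show "a \<le> x + e" using e by linarith
    qed (use * in auto)
    then have "finite (model i \<inter> ball x (e / 2))"
      by (rule finite_subset) (use e in \<open>intro finite_model_away_from_limits; simp\<close>)
    with lim e show False
      unfolding islimpt_eq_infinite_ball by (meson half_gt_zero)
  qed
next
  assume "x \<in> (\<lambda>k. 2 * real k + 1) ` {..<i}"
  then obtain k where k: "k < i" "x = 2 * real k + 1" by blast
  have "2 * real k + 1 + 1 / real (Suc n) \<in> model i - {x}" for n
    using modelI[of "{}" k i "Suc n"] k by simp
  moreover have "(\<lambda>n. 2 * real k + 1 + 1 / real (Suc n)) \<longlonglongrightarrow> x"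
    unfolding k by real_asymp
  ultimately show "x islimpt model i"
    unfolding islimpt_sequential
    by (intro exI[of _ "\<lambda>n. 2 * real k + 1 + 1 / real (Suc n)"]) simp
qed

lemma closed_model: "closed (model i)"
proof -
  \<comment> \<open>The limit points are elements of the model, with \<open>F = {}\<close> and
    \<open>m = 0\<close>.\<close>
  have "2 * real k + 1 \<in> model i" if "k < i" for k
    using modelI[of "{}" k i 0] that by simp
  then show ?thesis
    unfolding closed_limpt islimpt_model_iff by blast
qed

section \<open>Cones of the model sets\<close>

text \<open>An ultrafilter containing some \<open>{k}\<close> is principal, so here all complements
  of finite sets belong to \<mu>. This transfers statements about all large \<open>n\<close> to
  \<mu>.\<close>

lemma nonprincipal_ultrafilter_le_sequentially:
  assumes "nonprincipal_ultrafilter \<mu>"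
  shows "\<mu> \<le> sequentially"
proof -
  have ne: "eventually (\<lambda>n. n \<noteq> k) \<mu>" for k
  proof (rule ccontr)
    assume "\<not> eventually (\<lambda>n. n \<noteq> k) \<mu>"
    then have k: "eventually (\<lambda>n. n = k) \<mu>"
      using assms unfolding nonprincipal_ultrafilter_def ultrafilter_def by fastforce
    have "eventually P \<mu> \<longleftrightarrow> P k" for P
    proof
      assume "eventually P \<mu>"
      then have "eventually (\<lambda>n. P k) \<mu>"
        using k by eventually_elim simp
      then show "P k"
        using assms by (simp add: nonprincipal_ultrafilter_def ultrafilter_def)
    next
      assume "P k"
      with k show "eventually P \<mu>" by (auto elim: eventually_mono)
    qed
    then have "\<mu> = principal {k}"
      by (simp add: filter_eq_iff eventually_principal)
    then show False
      using assms by (simp add: nonprincipal_ultrafilter_def)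
  qed
  have "eventually (\<lambda>n. N \<le> n) \<mu>" for N
  proof -
    have "eventually (\<lambda>n. \<forall>k\<in>{..<N}. n \<noteq> k) \<mu>"
      by (rule eventually_ball_finite) (auto intro: ne)
    then show ?thesis
      by eventually_elim (use not_le in auto)
  qed
  then show ?thesis
    unfolding le_filter_def eventually_sequentially by (meson eventually_mono)
qed

text \<open>A positive finite limit keeps the quotients away from 0 and from infinity. This rules
  out the last two alternatives of \<open>model_rescale_down\<close>, and closedness of
  \<open>model (Suc i)\<close> gives the claim.\<close>

lemma model_limit:
  assumes le: "\<mu> \<le> sequentially" and "\<mu> \<noteq> bot"
    and b: "\<And>n. b n \<in> model i" and lim: "((\<lambda>n. b n / cone_scale n) \<longlongrightarrow> L) \<mu>"
  shows "L \<in> model (Suc i)"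
proof (cases "L = 0")
  case True
  then show ?thesis by (simp add: zero_in_model)
next
  case False
  have "0 \<le> L"
    using lim by (rule tendsto_lowerbound)
      (auto simp: model_nonneg[OF b] scale_pos less_imp_le \<open>\<mu> \<noteq> bot\<close>)
  with False have "0 < L" by simp
  have "((\<lambda>n. (2 * real (i + n) + 2) / 4 ^ n) \<longlongrightarrow> 0) \<mu>"
    by (rule tendsto_mono[OF le]) real_asymp
  then have "eventually (\<lambda>n. (2 * real (i + n) + 2) / 4 ^ n < L / 2) \<mu>"
    using \<open>0 < L\<close> by (intro order_tendstoD) auto
  moreover have "eventually (\<lambda>n. L / 2 < b n / cone_scale n) \<mu>"
    using \<open>0 < L\<close> by (intro order_tendstoD[OF lim]) simp
  moreover have "eventually (\<lambda>n. b n / cone_scale n < L + 1) \<mu>"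
    by (intro order_tendstoD[OF lim]) simp
  moreover have "eventually (\<lambda>n. L + 1 < cone_scale n) \<mu>"
    using le scaling_factor_scale
    by (auto simp: scaling_factor_def le_filter_def filterlim_at_top_dense)
  ultimately have "eventually (\<lambda>n. b n / cone_scale n \<in> model (Suc i)) \<mu>"
  proof eventually_elim
    case (elim n)
    then show ?case using model_rescale_down[OF b, of n n] by linarith
  qed
  then show ?thesis
    using Lim_in_closed_set[OF closed_model _ \<open>\<mu> \<noteq> bot\<close> lim] by blast
qed

lemma seq_dist_eqI:
  assumes "\<mu> \<noteq> bot" and "((\<lambda>n. mdist X (x n) (y n) / \<alpha> n) \<longlongrightarrow> d) \<mu>"
  shows "seq_dist \<mu> X \<alpha> x y = ennreal d"
  unfolding seq_dist_def using assms by (intro tendsto_Lim tendsto_ennrealI)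

text \<open>By induction, a point of the next cone is a sequence in \<open>model i\<close> up to
  equivalence, and its class is determined by the limit of the rescaled sequence. The clause on the
  base point is carried along because the next cone is formed around it.\<close>

lemma iterated_cone_isometric_model:
  assumes \<mu>: "nonprincipal_ultrafilter \<mu>"
  shows "\<exists>\<phi>. \<phi> ` model i = mspace (iterated_cone \<mu> (submetric euclidean_metric (model 0)) 0 cone_scale i)
    \<and> (\<forall>a\<in>model i. \<forall>b\<in>model i.
        mdist (iterated_cone \<mu> (submetric euclidean_metric (model 0)) 0 cone_scale i) (\<phi> a) (\<phi> b) = dist a b)
    \<and> \<phi> 0 = iterated_base \<mu> (submetric euclidean_metric (model 0)) 0 cone_scale i"
    (is "\<exists>\<phi>. \<phi> ` _ = mspace (?C i) \<and> _ \<and> _ = ?e i")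
proof (induction i)
  case 0
  have inj: "inj_on Base_Pt A" for A :: "real set"
    using inj_Base_Pt by (rule inj_on_subset) simp
  show ?case
    by (intro exI[of _ Base_Pt]) (auto simp: mdist_metric_image[OF inj])
next
  case (Suc i)
  then obtain \<phi> where \<phi>: "\<phi> ` model i = mspace (?C i)"
    and d: "\<And>a b. a \<in> model i \<Longrightarrow> b \<in> model i \<Longrightarrow> mdist (?C i) (\<phi> a) (\<phi> b) = dist a b"
    and \<phi>0: "\<phi> 0 = ?e i"
    by blast
  have uf: "ultrafilter \<mu>" and bot: "\<mu> \<noteq> bot" and le: "\<mu> \<le> sequentially"
    using \<mu> nonprincipal_ultrafilter_le_sequentially[OF \<mu>]
    by (auto simp: nonprincipal_ultrafilter_def ultrafilter_def)
  have e: "?e i \<in> mspace (?C i)"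
    using imageI[OF zero_in_model, of \<phi> i] \<phi> \<phi>0 by simp
  define seqs where "seqs = cone_seqs \<mu> (?C i) (\<lambda>_. ?e i) cone_scale"
  define cls where "cls = cone_class \<mu> (?C i) (\<lambda>_. ?e i) cone_scale"
  define Cn where "Cn = asymptotic_cone \<mu> (?C i) (\<lambda>_. ?e i) cone_scale"
  note inj = inj_on_encode_class[where \<mu> = \<mu> and \<alpha> = cone_scale and X = "?C i" and e = "\<lambda>_. ?e i",
      OF uf scale_pos e, folded Cn_def]
  \<comment> \<open>This is the standard sequence representing \<open>a\<close>. For
    \<open>a\<close> in \<open>model (Suc i)\<close> the default 0 occurs only finitely often, by
    \<open>model_rescale_up\<close>.\<close>
  define s where "s a n = (if cone_scale n * a \<in> model i then cone_scale n * a else 0)" for a n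
  have s_in: "s a n \<in> model i" for a n
    by (simp add: s_def zero_in_model)
  have s_ev: "eventually (\<lambda>n. s a n = cone_scale n * a) \<mu>" if "a \<in> model (Suc i)" for a
    using filter_leD[OF le model_rescale_up[OF that]] by eventually_elim (simp add: s_def)
  have s_lim: "((\<lambda>n. s a n / cone_scale n) \<longlongrightarrow> a) \<mu>" if "a \<in> model (Suc i)" for a
    using s_ev[OF that]
    by (intro tendsto_eventually, elim eventually_mono) (simp add: scale_pos less_imp_neq[symmetric])
  have sd: "seq_dist \<mu> (?C i) cone_scale (\<lambda>n. \<phi> (b n)) (\<lambda>n. \<phi> (c n)) = ennreal (dist x y)"
    if "\<And>n. b n \<in> model i" "\<And>n. c n \<in> model i"
      "((\<lambda>n. b n / cone_scale n) \<longlongrightarrow> x) \<mu>" "((\<lambda>n. c n / cone_scale n) \<longlongrightarrow> y) \<mu>" for b c x y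
  proof (rule seq_dist_eqI[OF bot])
    have "mdist (?C i) (\<phi> (b n)) (\<phi> (c n)) / cone_scale n = dist (b n / cone_scale n) (c n / cone_scale n)" for n
      using that scale_pos[of n] by (simp add: d dist_real_def flip: diff_divide_distrib)
    then show "((\<lambda>n. mdist (?C i) (\<phi> (b n)) (\<phi> (c n)) / cone_scale n) \<longlongrightarrow> dist x y) \<mu>"
      using tendsto_dist[OF that(3,4)] by simp
  qed
  have in_seqs: "(\<lambda>n. \<phi> (b n)) \<in> seqs"
    if "\<And>n. b n \<in> model i" "((\<lambda>n. b n / cone_scale n) \<longlongrightarrow> x) \<mu>" for b x
    using that \<phi> sd[of b "\<lambda>_. 0" x 0] unfolding seqs_def
    by (auto simp: cone_seqs_def zero_in_model \<phi>0)
  define \<psi> where "\<psi> a = cls (\<lambda>n. \<phi> (s a n))" for a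
  have \<psi>_in: "\<psi> a \<in> mspace Cn" if "a \<in> model (Suc i)" for a
    unfolding \<psi>_def cls_def Cn_def
    using in_seqs[OF s_in s_lim[OF that]] e unfolding seqs_def
    by (intro cone_class_in_mspace uf scale_pos)
  \<comment> \<open>The class depends only on the rescaled limit. This serves both surjectivity and
    the base point.\<close>
  have \<psi>_eq: "cls (\<lambda>n. \<phi> (b n)) = \<psi> x"
    if "\<And>n. b n \<in> model i" "((\<lambda>n. b n / cone_scale n) \<longlongrightarrow> x) \<mu>" "x \<in> model (Suc i)" for b x
    unfolding \<psi>_def cls_def cone_class_def
  proof (rule equiv_class_eq[OF equiv_cone_rel])
    show "(\<lambda>n. \<phi> (b n), \<lambda>n. \<phi> (s x n)) \<in> cone_rel \<mu> (?C i) (\<lambda>_. ?e i) cone_scale"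
      unfolding cone_rel_def
      using in_seqs[OF that(1,2)] in_seqs[OF s_in s_lim[OF that(3)]]
        sd[OF that(1) s_in that(2) s_lim[OF that(3)]]
      by (simp add: seqs_def)
  qed (use uf scale_pos e in auto)
  have surj: "A \<in> \<psi> ` model (Suc i)" if "A \<in> mspace Cn" for A
  proof -
    from that obtain y where y: "y \<in> seqs" "A = cls y"
      unfolding Cn_def mspace_asymptotic_cone[OF uf scale_pos e] seqs_def cls_def cone_class_def
      by (blast elim: quotientE)
    define b where "b n = (SOME a. a \<in> model i \<and> \<phi> a = y n)" for n
    have b: "b n \<in> model i" "\<phi> (b n) = y n" for n
    proof -
      have "\<exists>a. a \<in> model i \<and> \<phi> a = y n"
        using y \<phi> unfolding seqs_def cone_seqs_def by (metis (lifting) imageE mem_Collect_eq)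
      then show "b n \<in> model i" "\<phi> (b n) = y n"
        unfolding b_def by (metis (mono_tags, lifting) someI_ex)+
    qed
    \<comment> \<open>The base point corresponds to 0 and the model is nonnegative, so the distance
      to the base point recovers the coordinate itself. Finite distance from the base sequence thus
      becomes convergence of the rescaled coordinates.\<close>
    have "mdist (?C i) (y n) (?e i) = b n" for n
      using d[OF b(1)[of n] zero_in_model[of i]] model_nonneg[OF b(1)[of n]]
      by (simp add: b \<phi>0 dist_real_def)
    moreover obtain L where L: "seq_dist \<mu> (?C i) cone_scale y (\<lambda>_. ?e i) = ennreal L" "0 \<le> L"
      using y unfolding seqs_def cone_seqs_def
      by (metis (lifting) enn2real_nonneg ennreal_enn2real infinity_ennreal_def mem_Collect_eq)
    ultimately have "((\<lambda>n. ennreal (b n / cone_scale n)) \<longlongrightarrow> ennreal L) \<mu>"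
      using ultrafilter_tendsto_Lim[OF uf, of "\<lambda>n. ennreal (b n / cone_scale n)"]
      by (simp add: seq_dist_def)
    then have lim: "((\<lambda>n. b n / cone_scale n) \<longlongrightarrow> L) \<mu>"
      by (rule tendsto_ennrealD)
         (auto simp: L model_nonneg[OF b(1)] scale_pos less_imp_le intro!: always_eventually)
    have "L \<in> model (Suc i)"
      by (rule model_limit[OF le bot b(1) lim])
    with \<psi>_eq[OF b(1) lim] y b show ?thesis by auto
  qed
  have "mdist Cn (\<psi> a) (\<psi> b) = dist a b" if "a \<in> model (Suc i)" "b \<in> model (Suc i)" for a b
    unfolding Cn_def \<psi>_def cls_def
    using in_seqs[OF s_in s_lim] that sd[OF s_in s_in s_lim s_lim]
    by (subst mdist_asymptotic_cone[OF uf scale_pos e]) (auto simp: seqs_def)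
  then have "mdist (?C (Suc i)) (encode_class (\<psi> a)) (encode_class (\<psi> b)) = dist a b"
    if "a \<in> model (Suc i)" "b \<in> model (Suc i)" for a b
    using that inj by (simp add: mdist_metric_image \<psi>_in flip: Cn_def)
  moreover have "(encode_class \<circ> \<psi>) ` model (Suc i) = mspace (?C (Suc i))"
    using surj \<psi>_in by (auto simp flip: Cn_def image_image)
  \<comment> \<open>The constant sequence at the old base point has rescaled limit 0.\<close>
  moreover have "cls (\<lambda>n. \<phi> 0) = \<psi> 0"
    by (rule \<psi>_eq) (simp_all add: zero_in_model)
  then have "(encode_class \<circ> \<psi>) 0 = ?e (Suc i)"
    by (simp add: \<phi>0 cls_def)
  ultimately show ?case
    by (intro exI[of _ "encode_class \<circ> \<psi>"]) auto
qed

lemma iterated_cone_homeomorphic_model: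
  assumes "nonprincipal_ultrafilter \<mu>"
  shows "subtopology euclidean (model i) homeomorphic_space
    mtopology_of (iterated_cone \<mu> (submetric euclidean_metric (model 0)) 0 cone_scale i)"
    (is "_ homeomorphic_space mtopology_of ?C")
proof -
  obtain \<phi> where \<phi>: "\<phi> ` model i = mspace ?C"
    and d: "\<And>a b. a \<in> model i \<Longrightarrow> b \<in> model i \<Longrightarrow> mdist ?C (\<phi> a) (\<phi> b) = dist a b"
    using iterated_cone_isometric_model[OF assms] by meson
  let ?A = "submetric euclidean_metric (model i)"
  interpret Metric_space12 "mspace ?A" "mdist ?A" "mspace ?C" "mdist ?C"
    by (rule Metric_space12_mspace_mdist)
  have "homeomorphic_map (mtopology_of ?A) (mtopology_of ?C) \<phi>"
    unfolding mtopology_of_def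
    by (rule isometry_imp_homeomorphic_map) (use \<phi> d in auto)
  then show ?thesis
    unfolding mtopology_of_submetric by (auto intro: homeomorphic_map_imp_homeomorphic_space)
qed

section \<open>Counting non-isolated points\<close>

text \<open>A homeomorphism maps the non-isolated points bijectively onto the non-isolated points;
  their number is the invariant that separates the cones.\<close>

lemma homeomorphic_space_card_derived_set:
  assumes "X homeomorphic_space Y"
  shows "card (X derived_set_of topspace X) = card (Y derived_set_of topspace Y)"
proof -
  obtain f where f: "homeomorphic_map X Y f"
    using assms by (auto simp: homeomorphic_space)
  then have "Y derived_set_of topspace Y = f ` (X derived_set_of topspace X)"
    using homeomorphic_map_derived_set_of[OF f order_refl] homeomorphic_imp_surjective_map[OF f]
    by simp
  moreover have "inj_on f (X derived_set_of topspace X)"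
    using homeomorphic_imp_injective_map[OF f] derived_set_of_subset_topspace
    by (rule inj_on_subset)
  ultimately show ?thesis by (simp add: card_image)
qed

text \<open>Since the model is closed, its limit points in the line are exactly its non-isolated
  points as a subspace, namely the \<open>i\<close> distinct centres.\<close>

lemma card_derived_set_model:
  "card (subtopology euclidean (model i) derived_set_of topspace (subtopology euclidean (model i))) = i"
proof -
  have "euclidean derived_set_of model i = {x. x islimpt model i}"
    unfolding derived_set_of_def islimpt_def by auto
  moreover have "{x. x islimpt model i} \<subseteq> model i"
    using closed_model closed_limpt by blast
  ultimately have "subtopology euclidean (model i) derived_set_of
      topspace (subtopology euclidean (model i)) = (\<lambda>k. 2 * real k + 1) ` {..<i}"
    by (auto simp: derived_set_of_subtopology islimpt_model_iff)
  then show ?thesis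
    by (simp add: card_image inj_on_def)
qed

theorem theorem2p7:
  shows "\<exists>(X :: real metric) (e :: real) (\<alpha> :: nat \<Rightarrow> real).
    e \<in> mspace X \<and> scaling_factor \<alpha> \<and>
    (\<forall>\<mu> :: nat filter. nonprincipal_ultrafilter \<mu> \<longrightarrow>
      (\<forall>i j :: nat. i \<noteq> j \<longrightarrow>
        \<not> (mtopology_of (iterated_cone \<mu> X e \<alpha> i) homeomorphic_space
           mtopology_of (iterated_cone \<mu> X e \<alpha> j))))"
proof (intro exI conjI allI impI notI)
  let ?X = "submetric euclidean_metric (model 0)"
  show "0 \<in> mspace ?X" by (simp add: zero_in_model)
  show "scaling_factor cone_scale" by (rule scaling_factor_scale)
  fix \<mu> :: "nat filter" and i j :: nat
  assume \<mu>: "nonprincipal_ultrafilter \<mu>" and "i \<noteq> j"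
    and "mtopology_of (iterated_cone \<mu> ?X 0 cone_scale i) homeomorphic_space
      mtopology_of (iterated_cone \<mu> ?X 0 cone_scale j)"
  then have "subtopology euclidean (model i) homeomorphic_space subtopology euclidean (model j)"
    by (meson homeomorphic_space_sym homeomorphic_space_trans iterated_cone_homeomorphic_model)
  \<comment> \<open>The two models have \<open>i\<close> and \<open>j\<close> non-isolated points
    respectively.\<close>
  from homeomorphic_space_card_derived_set[OF this] \<open>i \<noteq> j\<close> show False
    by (simp only: card_derived_set_model)
qed

end
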